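(* Consider a weighted-POMDP with state set $S$, initial state $\bar{s}$, actions $A$, observations $Z$, and specification $\phi=P_{\unlhd p}[\phi_1\,\mathcal{U}^{\leq k}\phi_2]$, modified so that all states satisfying $\neg\phi_1$ or $\phi_2$ are absorbing, and let $\Delta=\{s\in S: s\models\phi_2\}$. With the value functions $V_t$ defined in the context, for every $k\ge 0$ and every history $h$, $V_k(h)$ equals the maximum (over actions chosen as functions of histories) accumulated weighted probability mass of paths satisfying $\phi_1\,\mathcal{U}^{\leq k}\phi_2$ starting from history $h$, i.e. the maximum weighted probability mass, starting from the weighted belief $C(h)\,b(\cdot|h)$, of reaching $\Delta$ within at most $k$ steps.
   Context: A weighted-POMDP is a tuple $\{S,\bar{s},A,Z,T,O\}$ as a POMDP (finite $S,A,Z$; $O:S\times Z\to[0,1]$ with $\sum_{z}O(s,z)=1$ for all $s$) except that $T:S\times A\times S\to[0,1]$ need not satisfy $\sum_{s'}T(s,a,s')=1$ (the sum may exceed $1$). A history is $h_t=a_0z_1\dots a_{t-1}z_t$; $h_0$ is the empty history. Define $C(h_0)=1$, $b(s|h_0)=1$ if $s=\bar{s}$ and $0$ otherwise, and for a history $h$ extended by $a,z$: $b(s'|haz)=\dfrac{\sum_{s}O(s',z)T(s,a,s')b(s|h)C(h)}{\sum_{s''}\sum_{s}O(s'',z)T(s,a,s'')b(s|h)C(h)}$, $\;C(haz)=C(h)\sum_{s}\sum_{s'}b(s|h)T(s,a,s')$. Derived MDP on histories: $T_M(h,a,haz)=\dfrac{\sum_{s''}\sum_{s}O(s'',z)T(s,a,s'')b(s|h)C(h)}{\sum_{z'\in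 Z}\sum_{s''}\sum_{s}O(s'',z')T(s,a,s'')b(s|h)C(h)}$. Value functions: $V_0(h)=C(h)\sum_{s\in\Delta}b(s|h)$ and $V_t(h)=\max_{a\in A}\sum_{z\in Z}T_M(h,a,haz)V_{t-1}(haz)$ for $t\ge1$. *)

theory Defs
  imports Complex_Main
begin

text \<open>The finite sets of states, actions and observations are finite types. Row sums of
  \<open>wtrans\<close> are unconstrained.\<close>

record ('s, 'a, 'z) wpomdp =
  init :: 's
  wtrans :: "'s \<Rightarrow> 'a \<Rightarrow> 's \<Rightarrow> real"
  obs :: "'s \<Rightarrow> 'z \<Rightarrow> real"

definition weighted_pomdp :: "('s::finite, 'a::finite, 'z::finite) wpomdp \<Rightarrow> bool" where
  "weighted_pomdp M \<longleftrightarrow>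
     (\<forall>s a s'. 0 \<le> wtrans M s a s' \<and> wtrans M s a s' \<le> 1) \<and>
     (\<forall>s z. 0 \<le> obs M s z \<and> obs M s z \<le> 1) \<and>
     (\<forall>s. (\<Sum>z\<in>UNIV. obs M s z) = 1)"

definition make_absorbing :: "('s \<Rightarrow> bool) \<Rightarrow> ('s, 'a, 'z) wpomdp \<Rightarrow> ('s, 'a, 'z) wpomdp" where
  "make_absorbing P M =
     M\<lparr>wtrans := (\<lambda>s a s'. if P s then (if s' = s then 1 else 0) else wtrans M s a s')\<rparr>"

text \<open>\<open>Ext h a z\<close> is the history \<open>haz\<close>.\<close>

datatype ('a, 'z) history = Empty | Ext "('a, 'z) history" 'a 'z

text \<open>\<open>weight\<close> is \<open>C\<close>. If the normalising sum of a belief (or of \<open>hist_trans\<close> below)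
  vanishes, the quotient is \<open>0\<close>.\<close>

fun belief :: "('s::finite, 'a, 'z) wpomdp \<Rightarrow> ('a, 'z) history \<Rightarrow> 's \<Rightarrow> real"
  and weight :: "('s::finite, 'a, 'z) wpomdp \<Rightarrow> ('a, 'z) history \<Rightarrow> real"
where
  "belief M Empty s' = (if s' = init M then 1 else 0)"
| "belief M (Ext h a z) s' =
     (\<Sum>s\<in>UNIV. obs M s' z * wtrans M s a s' * belief M h s * weight M h) /
     (\<Sum>s''\<in>UNIV. \<Sum>s\<in>UNIV. obs M s'' z * wtrans M s a s'' * belief M h s * weight M h)"
| "weight M Empty = 1"
| "weight M (Ext h a z) =
     weight M h * (\<Sum>s\<in>UNIV. \<Sum>s'\<in>UNIV. belief M h s * wtrans M s a s')"

text \<open>\<open>hist_trans M h a z\<close> is \<open>T\<^sub>M(h, a, haz)\<close>.\<close>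

definition hist_trans ::
  "('s::finite, 'a, 'z::finite) wpomdp \<Rightarrow> ('a, 'z) history \<Rightarrow> 'a \<Rightarrow> 'z \<Rightarrow> real" where
  "hist_trans M h a z =
     (\<Sum>s''\<in>UNIV. \<Sum>s\<in>UNIV. obs M s'' z * wtrans M s a s'' * belief M h s * weight M h) /
     (\<Sum>z'\<in>UNIV. \<Sum>s''\<in>UNIV. \<Sum>s\<in>UNIV.
        obs M s'' z' * wtrans M s a s'' * belief M h s * weight M h)"

fun value_fn ::
  "('s::finite, 'a::finite, 'z::finite) wpomdp \<Rightarrow> 's set \<Rightarrow> nat \<Rightarrow> ('a, 'z) history \<Rightarrow> real"
where
  "value_fn M \<Delta> 0 h = weight M h * (\<Sum>s\<in>\<Delta>. belief M h s)"
| "value_fn M \<Delta> (Suc t) h =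
     (MAX a\<in>UNIV. \<Sum>z\<in>UNIV. hist_trans M h a z * value_fn M \<Delta> t (Ext h a z))"

text \<open>A path continuing history \<open>h\<close> from state \<open>s\<^sub>0\<close> is given by the list of pairs
  \<open>(z\<^sub>1, s\<^sub>1), \<dots>, (z\<^sub>k, s\<^sub>k)\<close> of subsequent observations and states; the actions
  are those chosen by the strategy \<open>\<sigma>\<close> on the growing history.\<close>

fun path_weight ::
  "('s, 'a, 'z) wpomdp \<Rightarrow> (('a, 'z) history \<Rightarrow> 'a) \<Rightarrow> ('a, 'z) history \<Rightarrow> 's \<Rightarrow> ('z \<times> 's) list \<Rightarrow> real"
where
  "path_weight M \<sigma> h s [] = 1"
| "path_weight M \<sigma> h s ((z, s') # w) =
     wtrans M s (\<sigma> h) s' * obs M s' z * path_weight M \<sigma> (Ext h (\<sigma> h) z) s' w"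

definition path_mass ::
  "('s::finite, 'a, 'z::finite) wpomdp \<Rightarrow> (('a, 'z) history \<Rightarrow> 'a) \<Rightarrow> ('a, 'z) history \<Rightarrow> nat
     \<Rightarrow> ('s list \<Rightarrow> bool) \<Rightarrow> real" where
  "path_mass M \<sigma> h k P =
     (\<Sum>s\<in>UNIV. \<Sum>w | length w = k \<and> P (s # map snd w).
        weight M h * belief M h s * path_weight M \<sigma> h s w)"

definition bounded_until :: "('s \<Rightarrow> bool) \<Rightarrow> ('s \<Rightarrow> bool) \<Rightarrow> nat \<Rightarrow> 's list \<Rightarrow> bool" where
  "bounded_until \<phi>\<^sub>1 \<phi>\<^sub>2 k ss \<longleftrightarrow>
     (\<exists>i\<le>k. i < length ss \<and> \<phi>\<^sub>2 (ss ! i) \<and> (\<forall>j<i. \<phi>\<^sub>1 (ss ! j)))"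

definition bounded_reach :: "'s set \<Rightarrow> nat \<Rightarrow> 's list \<Rightarrow> bool" where
  "bounded_reach \<Delta> k ss \<longleftrightarrow> (\<exists>i\<le>k. i < length ss \<and> ss ! i \<in> \<Delta>)"

definition is_maximum :: "real \<Rightarrow> real set \<Rightarrow> bool" where
  "is_maximum m X \<longleftrightarrow> m \<in> X \<and> (\<forall>x\<in>X. x \<le> m)"

end

theory Submission
  imports Defs
begin

text \<open>Write \<open>\<omega>\<^sub>h(s) = C(h) b(s|h)\<close>. The normalising factors in \<open>T\<^sub>M\<close>, \<open>b\<close> and \<open>C\<close> cancel, so that
  \<open>T\<^sub>M(h,a,haz) \<omega>\<^bsub>haz\<^esub>(s') = \<Sum>\<^sub>s O(s',z) T(s,a,s') \<omega>\<^sub>h(s)\<close>: along a history, \<open>V\<^sub>t\<close> propagates exactly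
  the weighted path mass. On paths of nonzero weight the absorbing states turn \<open>\<phi>\<^sub>1 \<U>\<^sup>\<le>\<^sup>k \<phi>\<^sub>2\<close> into
  the statement that the last state lies in \<open>\<Delta>\<close>, and the mass of these paths under a fixed strategy
  satisfies the recursion of \<open>V\<^sub>t\<close> without the maximum. A strategy that is greedy for the remaining
  horizon attains the maximum.\<close>

section \<open>Absorbing states and bounded until\<close>

lemma weighted_pomdp_make_absorbing:
  assumes "weighted_pomdp M"
  shows "weighted_pomdp (make_absorbing P M)"
  using assms by (auto simp: weighted_pomdp_def make_absorbing_def)

text \<open>Every move away from \<open>s\<close> contributes a factor 0, so a nonzero product
  consists of self-loops only.\<close>

lemma path_weight_absorbing:
  assumes "\<And>a s'. s' \<noteq> s \<Longrightarrow> wtrans M s a s' = 0"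
    and "path_weight M \<sigma> h s w \<noteq> 0"
  shows "set (map snd w) \<subseteq> {s}"
  using assms(2)
proof (induction w arbitrary: h)
  case (Cons p w)
  obtain z s' where p: "p = (z, s')" by fastforce
  with Cons.prems assms(1) have "s' = s" by fastforce
  with Cons p show ?case by auto
qed simp

lemma bounded_until_Cons:
  "bounded_until \<phi>\<^sub>1 \<phi>\<^sub>2 (Suc k) (s # ss) \<longleftrightarrow> \<phi>\<^sub>2 s \<or> \<phi>\<^sub>1 s \<and> bounded_until \<phi>\<^sub>1 \<phi>\<^sub>2 k ss"
  (is "?L \<longleftrightarrow> ?R")
proof
  assume ?L
  then obtain i where i: "i \<le> Suc k" "i < length (s # ss)" "\<phi>\<^sub>2 ((s # ss) ! i)"
    "\<forall>j<i. \<phi>\<^sub>1 ((s # ss) ! j)"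
    by (auto simp: bounded_until_def)
  show ?R
  proof (cases i)
    case (Suc j)
    then have "\<forall>l<j. \<phi>\<^sub>1 (ss ! l)" "\<phi>\<^sub>1 s" using i(4) by fastforce+
    then show ?thesis using i Suc by (auto simp: bounded_until_def)
  qed (use i in auto)
next
  assume ?R
  then show ?L
  proof
    assume "\<phi>\<^sub>1 s \<and> bounded_until \<phi>\<^sub>1 \<phi>\<^sub>2 k ss"
    then obtain i where "i \<le> k" "i < length ss" "\<phi>\<^sub>2 (ss ! i)" "\<forall>j<i. \<phi>\<^sub>1 (ss ! j)" "\<phi>\<^sub>1 s"
      by (auto simp: bounded_until_def)
    then show ?L
      unfolding bounded_until_def
      by (intro exI[of _ "Suc i"]) (auto simp: less_Suc_eq_0_disj)
  qed (auto simp: bounded_until_def)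
qed

lemma bounded_until_imp_set:
  "bounded_until \<phi>\<^sub>1 \<phi>\<^sub>2 k ss \<Longrightarrow> \<exists>s\<in>set ss. \<phi>\<^sub>2 s"
  by (auto simp: bounded_until_def)

lemma bounded_reach_eq_bounded_until:
  "bounded_reach {s. \<phi> s} k = bounded_until (\<lambda>_. True) \<phi> k"
  by (auto simp: bounded_reach_def bounded_until_def fun_eq_iff)

text \<open>A path of nonzero weight never leaves the first state it meets that violates
  \<open>\<phi>\<^sub>1\<close> or satisfies \<open>\<phi>\<^sub>2\<close>, so its last state
  records how that state decided the until formula. The weaker \<open>\<psi>\<close> lets one
  induction serve both until (\<open>\<psi>\<close> is \<open>\<phi>\<^sub>1\<close>) and plain
  reachability (\<open>\<psi>\<close> is always true).\<close>

lemma bounded_until_iff_last: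
  assumes "path_weight (make_absorbing (\<lambda>s. \<not> \<phi>\<^sub>1 s \<or> \<phi>\<^sub>2 s) M) \<sigma> h s w \<noteq> 0"
    and "\<And>s. \<phi>\<^sub>1 s \<Longrightarrow> \<psi> s"
  shows "bounded_until \<psi> \<phi>\<^sub>2 (length w) (s # map snd w) \<longleftrightarrow> \<phi>\<^sub>2 (last (s # map snd w))"
  using assms(1)
proof (induction w arbitrary: h s)
  case Nil
  then show ?case by (auto simp: bounded_until_def)
next
  case (Cons p w)
  show ?case
  proof (cases "\<not> \<phi>\<^sub>1 s \<or> \<phi>\<^sub>2 s")
    case True
    then have "set (map snd (p # w)) \<subseteq> {s}"
      using Cons.prems by (intro path_weight_absorbing) (auto simp: make_absorbing_def)
    then have sub: "set (s # map snd (p # w)) \<subseteq> {s}" by simp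
    then have "last (s # map snd (p # w)) = s"
      by (meson last_in_set list.discI singletonD subsetD)
    \<comment> \<open>The path is constantly \<open>s\<close>: index 0 is a witness if
      \<open>\<phi>\<^sub>2 s\<close> holds, and any witness is \<open>s\<close> itself.\<close>
    moreover have "bounded_until \<psi> \<phi>\<^sub>2 (length (p # w)) (s # map snd (p # w)) \<longleftrightarrow> \<phi>\<^sub>2 s"
      using sub bounded_until_imp_set[of \<psi> \<phi>\<^sub>2 "length (p # w)" "s # map snd (p # w)"]
      by (fastforce simp: bounded_until_Cons)
    ultimately show ?thesis by simp
  next
    case False
    obtain z s' where p: "p = (z, s')" by fastforce
    have "bounded_until \<psi> \<phi>\<^sub>2 (length w) (s' # map snd w) \<longleftrightarrow> \<phi>\<^sub>2 (last (s' # map snd w))"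
      by (rule Cons.IH[of "Ext h (\<sigma> h) z"]) (use Cons.prems p in auto)
    with False assms(2)[of s] p show ?thesis
      by (simp add: bounded_until_Cons)
  qed
qed

section \<open>Path mass determined by the last state\<close>

definition last_mass where
  "last_mass M \<Delta> \<sigma> h k s =
     (\<Sum>w | length w = k \<and> last (s # map snd w) \<in> \<Delta>. path_weight M \<sigma> h s w)"

definition strategy_value where
  "strategy_value M \<Delta> \<sigma> k h =
     (\<Sum>s\<in>UNIV. weight M h * belief M h s * last_mass M \<Delta> \<sigma> h k s)"

lemma finite_lists_length_finite_type: "finite {w :: 'b::finite list. length w = k \<and> P w}"
  using finite_lists_length_eq[of "UNIV :: 'b set" k] by (rule rev_finite_subset) auto

lemma path_mass_bounded_until:
  fixes M :: "('s::finite, 'a::finite, 'z::finite) wpomdp"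
  assumes M: "M = make_absorbing (\<lambda>s. \<not> \<phi>\<^sub>1 s \<or> \<phi>\<^sub>2 s) M\<^sub>0"
    and \<psi>: "\<And>s. \<phi>\<^sub>1 s \<Longrightarrow> \<psi> s"
  shows "path_mass M \<sigma> h k (bounded_until \<psi> \<phi>\<^sub>2 k) = strategy_value M {s. \<phi>\<^sub>2 s} \<sigma> k h"
  unfolding path_mass_def strategy_value_def last_mass_def sum_distrib_left
proof (rule sum.cong[OF refl])
  fix s
  have iff: "bounded_until \<psi> \<phi>\<^sub>2 k (s # map snd w) \<longleftrightarrow> last (s # map snd w) \<in> {s. \<phi>\<^sub>2 s}"
    if "path_weight M \<sigma> h s w \<noteq> 0" "length w = k" for w
    using bounded_until_iff_last[of \<phi>\<^sub>1 \<phi>\<^sub>2 M\<^sub>0 \<sigma> h s w \<psi>] that M \<psi> by blast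
  show "(\<Sum>w | length w = k \<and> bounded_until \<psi> \<phi>\<^sub>2 k (s # map snd w).
           weight M h * belief M h s * path_weight M \<sigma> h s w) =
        (\<Sum>w | length w = k \<and> last (s # map snd w) \<in> {s. \<phi>\<^sub>2 s}.
           weight M h * belief M h s * path_weight M \<sigma> h s w)"
    \<comment> \<open>The two index sets differ only in paths of weight 0.\<close>
    by (rule sum.mono_neutral_cong[OF finite_lists_length_finite_type finite_lists_length_finite_type])
      (use iff in \<open>auto simp del: last.simps\<close>)
qed

text \<open>A condition on the last state is insensitive to removing the first state of a nonempty
  path, so splitting off the first pair leaves a sum of the same kind from
  \<open>s'\<close>.\<close>

lemma last_mass_Suc:
  fixes M :: "('s::finite, 'a, 'z::finite) wpomdp"
  shows "last_mass M \<Delta> \<sigma> h (Suc k) s =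
    (\<Sum>z\<in>UNIV. \<Sum>s'\<in>UNIV.
       wtrans M s (\<sigma> h) s' * obs M s' z * last_mass M \<Delta> \<sigma> (Ext h (\<sigma> h) z) k s')"
proof -
  let ?B = "\<lambda>p. {w :: ('z \<times> 's) list. length w = k \<and> last (snd p # map snd w) \<in> \<Delta>}"
  have img: "{w. length w = Suc k \<and> last (s # map snd w) \<in> \<Delta>} =
      (\<lambda>(p, w). p # w) ` Sigma UNIV ?B"
    by (auto simp: length_Suc_conv image_iff)
  have "last_mass M \<Delta> \<sigma> h (Suc k) s =
      (\<Sum>(p, w)\<in>Sigma UNIV ?B. path_weight M \<sigma> h s (p # w))"
    unfolding last_mass_def img
    by (subst sum.reindex) (auto simp: inj_on_def intro!: sum.cong)
  also have "\<dots> = (\<Sum>p\<in>UNIV. \<Sum>w\<in>?B p. path_weight M \<sigma> h s (p # w))"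
    by (rule sum.Sigma[symmetric]) (simp_all add: finite_lists_length_finite_type del: last.simps)
  also have "\<dots> = (\<Sum>(z, s')\<in>UNIV \<times> UNIV.
      wtrans M s (\<sigma> h) s' * obs M s' z * last_mass M \<Delta> \<sigma> (Ext h (\<sigma> h) z) k s')"
    by (auto simp: last_mass_def sum_distrib_left intro!: sum.cong)
  finally show ?thesis
    by (simp add: sum.cartesian_product)
qed

section \<open>Cancellation of the normalising factors\<close>

lemma belief_weight_nonneg:
  assumes "weighted_pomdp M"
  shows "0 \<le> belief M h s" and "0 \<le> weight M h"
proof -
  have "(\<forall>s. 0 \<le> belief M h s) \<and> 0 \<le> weight M h"
    using assms by (induction h)
      (auto simp: weighted_pomdp_def intro!: sum_nonneg mult_nonneg_nonneg divide_nonneg_nonneg)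
  then show "0 \<le> belief M h s" and "0 \<le> weight M h" by auto
qed

lemma hist_trans_nonneg:
  assumes "weighted_pomdp M"
  shows "0 \<le> hist_trans M h a z"
  using assms belief_weight_nonneg[OF assms] unfolding hist_trans_def weighted_pomdp_def
  by (auto intro!: sum_nonneg mult_nonneg_nonneg divide_nonneg_nonneg)

text \<open>With \<open>N\<close> the unnormalised successor mass, \<open>D z\<close> its total for
  observation \<open>z\<close>, and E the sum of all \<open>D z\<close>, the left side is (D/E) * (E
  * (N/D)).\<close>

lemma hist_trans_weighted_belief:
  fixes M :: "('s::finite, 'a::finite, 'z::finite) wpomdp"
  assumes "weighted_pomdp M"
  shows "hist_trans M h a z * (weight M (Ext h a z) * belief M (Ext h a z) s') =
    (\<Sum>s\<in>UNIV. obs M s' z * wtrans M s a s' * belief M h s * weight M h)"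
proof -
  define N where "N z s' = (\<Sum>s\<in>UNIV. obs M s' z * wtrans M s a s' * belief M h s * weight M h)"
    for z s'
  define D where "D z = (\<Sum>s'\<in>UNIV. N z s')" for z
  have N_nonneg: "0 \<le> N z s'" for z s'
    unfolding N_def using assms belief_weight_nonneg[OF assms]
    by (auto simp: weighted_pomdp_def intro!: sum_nonneg mult_nonneg_nonneg)
  then have D_nonneg: "0 \<le> D z" for z
    by (simp add: D_def sum_nonneg)
  \<comment> \<open>Summing over observations first uses that each row of \<open>obs\<close> sums to
    1; what remains is C(haz), which does not depend on \<open>z\<close>.\<close>
  have "(\<Sum>z\<in>UNIV. D z) = (\<Sum>s'\<in>UNIV. \<Sum>s\<in>UNIV. \<Sum>z\<in>UNIV.
      obs M s' z * (wtrans M s a s' * belief M h s * weight M h))"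
    unfolding D_def N_def
    by (subst sum.swap, rule sum.cong[OF refl], subst sum.swap) (simp add: mult.assoc)
  also have "\<dots> = (\<Sum>s'\<in>UNIV. \<Sum>s\<in>UNIV. wtrans M s a s' * belief M h s * weight M h)"
    using assms by (simp add: weighted_pomdp_def flip: sum_distrib_right)
  also have "\<dots> = weight M (Ext h a z)"
    by (subst sum.swap) (simp add: sum_distrib_left mult_ac)
  finally have E: "weight M (Ext h a z) = (\<Sum>z\<in>UNIV. D z)" ..
  have T: "hist_trans M h a z = D z / (\<Sum>z\<in>UNIV. D z)"
    by (simp add: hist_trans_def D_def N_def)
  have b: "belief M (Ext h a z) s' = N z s' / D z"
    by (simp add: D_def N_def)
  have "D z / (\<Sum>z\<in>UNIV. D z) * ((\<Sum>z\<in>UNIV. D z) * (N z s' / D z)) = N z s'"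
  \<comment> \<open>If \<open>D z\<close> vanishes, the left side is 0 by the convention on
    quotients, and nonnegativity makes each \<open>N z s'\<close> vanish too. Otherwise
    nonnegativity keeps the sum of all \<open>D z\<close> nonzero, and both factors cancel.\<close>
  proof (cases "D z = 0")
    case True
    then have "N z s' = 0"
      using N_nonneg by (simp add: D_def sum_nonneg_eq_0_iff)
    then show ?thesis by simp
  next
    case False
    then have "(\<Sum>z\<in>UNIV. D z) \<noteq> 0"
      using D_nonneg by (auto simp: sum_nonneg_eq_0_iff)
    with False show ?thesis by simp
  qed
  then show ?thesis
    unfolding E T b N_def .
qed

section \<open>Recursion for a fixed strategy\<close>

lemma strategy_value_0:
  fixes M :: "('s::finite, 'a::finite, 'z::finite) wpomdp"
  shows "strategy_value M \<Delta> \<sigma> 0 h = value_fn M \<Delta> 0 h"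
proof -
  have "last_mass M \<Delta> \<sigma> h 0 s = (if s \<in> \<Delta> then 1 else 0)" for s
  proof -
    have "{w :: ('z \<times> 's) list. length w = 0 \<and> last (s # map snd w) \<in> \<Delta>} =
        (if s \<in> \<Delta> then {[]} else {})" by auto
    then show ?thesis by (simp add: last_mass_def)
  qed
  then have "strategy_value M \<Delta> \<sigma> 0 h =
      (\<Sum>s\<in>UNIV. if s \<in> \<Delta> then weight M h * belief M h s else 0)"
    unfolding strategy_value_def by (intro sum.cong) auto
  then show ?thesis
    by (simp add: sum_distrib_left sum.If_cases)
qed

lemma strategy_value_Suc:
  fixes M :: "('s::finite, 'a::finite, 'z::finite) wpomdp"
  assumes "weighted_pomdp M"
  shows "strategy_value M \<Delta> \<sigma> (Suc k) h =
    (\<Sum>z\<in>UNIV. hist_trans M h (\<sigma> h) z * strategy_value M \<Delta> \<sigma> k (Ext h (\<sigma> h) z))"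
proof -
  let ?g = "\<lambda>z. Ext h (\<sigma> h) z"
  let ?f = "\<lambda>s z s'. obs M s' z * wtrans M s (\<sigma> h) s' * belief M h s * weight M h *
      last_mass M \<Delta> \<sigma> (?g z) k s'"
  have "strategy_value M \<Delta> \<sigma> (Suc k) h = (\<Sum>s\<in>UNIV. \<Sum>z\<in>UNIV. \<Sum>s'\<in>UNIV. ?f s z s')"
    by (simp add: strategy_value_def last_mass_Suc sum_distrib_left mult_ac)
  \<comment> \<open>The sum over the current state \<open>s\<close> goes innermost, where it is the
    right side of \<open>hist_trans_weighted_belief\<close>.\<close>
  also have "\<dots> = (\<Sum>z\<in>UNIV. \<Sum>s'\<in>UNIV. \<Sum>s\<in>UNIV. ?f s z s')"
    by (subst sum.swap, rule sum.cong[OF refl], rule sum.swap)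
  also have "\<dots> = (\<Sum>z\<in>UNIV. \<Sum>s'\<in>UNIV. hist_trans M h (\<sigma> h) z *
      (weight M (?g z) * belief M (?g z) s') * last_mass M \<Delta> \<sigma> (?g z) k s')"
    by (simp only: hist_trans_weighted_belief[OF assms] sum_distrib_right)
  also have "\<dots> = (\<Sum>z\<in>UNIV. hist_trans M h (\<sigma> h) z * strategy_value M \<Delta> \<sigma> k (?g z))"
    by (simp only: strategy_value_def sum_distrib_left mult.assoc)
  finally show ?thesis .
qed

section \<open>Upper bound and its attainment\<close>

lemma strategy_value_le_value_fn:
  assumes "weighted_pomdp M"
  shows "strategy_value M \<Delta> \<sigma> k h \<le> value_fn M \<Delta> k h"
proof (induction k arbitrary: h)
  case 0
  show ?case by (simp only: strategy_value_0)
next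
  case (Suc k)
  \<comment> \<open>Nonnegative transition weights allow the induction hypothesis to be applied
    termwise; then \<open>\<sigma> h\<close> is one candidate in the maximum.\<close>
  have "strategy_value M \<Delta> \<sigma> (Suc k) h \<le>
      (\<Sum>z\<in>UNIV. hist_trans M h (\<sigma> h) z * value_fn M \<Delta> k (Ext h (\<sigma> h) z))"
    unfolding strategy_value_Suc[OF assms]
    by (intro sum_mono mult_left_mono Suc.IH hist_trans_nonneg assms)
  also have "\<dots> \<le> value_fn M \<Delta> (Suc k) h"
    by (auto intro: Max_ge)
  finally show ?case .
qed

text \<open>The optimal action depends on the remaining horizon, which a strategy reads off the length of
  the history; \<open>n\<close> is the total length at which the game ends.\<close>

definition greedy_strategy where
  "greedy_strategy M \<Delta> n g =
     (SOME a. (\<Sum>z\<in>UNIV. hist_trans M g a z * value_fn M \<Delta> (n - Suc (size g)) (Ext g a z)) =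
        value_fn M \<Delta> (Suc (n - Suc (size g))) g)"

lemma greedy_strategy_action:
  fixes M :: "('s::finite, 'a::finite, 'z::finite) wpomdp"
  assumes "n = Suc k + size g"
  shows "(\<Sum>z\<in>UNIV. hist_trans M g (greedy_strategy M \<Delta> n g) z *
      value_fn M \<Delta> k (Ext g (greedy_strategy M \<Delta> n g) z)) = value_fn M \<Delta> (Suc k) g"
proof -
  let ?Q = "\<lambda>a. \<Sum>z\<in>UNIV. hist_trans M g a z * value_fn M \<Delta> k (Ext g a z)"
  have "Max (range ?Q) \<in> range ?Q"
    by (rule Max_in) auto
  then have "\<exists>a. ?Q a = value_fn M \<Delta> (Suc k) g"
    unfolding value_fn.simps by (metis (no_types, lifting) imageE)
  then have "?Q (SOME a. ?Q a = value_fn M \<Delta> (Suc k) g) = value_fn M \<Delta> (Suc k) g"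
    by (rule someI_ex)
  \<comment> \<open>The horizon left after the chosen action is one less than the horizon at
    \<open>g\<close>, hence the \<open>Suc\<close> in the subtraction.\<close>
  moreover have "n - Suc (size g) = k" using assms by simp
  ultimately show ?thesis by (simp only: greedy_strategy_def)
qed

text \<open>Each step lowers \<open>k\<close> by one and lengthens the history by one, so
  \<open>n\<close> stays fixed and a single strategy is greedy throughout the induction.\<close>

lemma strategy_value_greedy:
  fixes M :: "('s::finite, 'a::finite, 'z::finite) wpomdp"
  assumes "weighted_pomdp M" and "n = k + size h"
  shows "strategy_value M \<Delta> (greedy_strategy M \<Delta> n) k h = value_fn M \<Delta> k h"
  using assms(2)
proof (induction k arbitrary: h)
  case 0
  show ?case by (rule strategy_value_0)
next
  case (Suc k)
  have "strategy_value M \<Delta> (greedy_strategy M \<Delta> n) k (Ext h a z) = value_fn M \<Delta> k (Ext h a z)"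
    for a z
    using Suc.prems by (intro Suc.IH) simp
  then show ?case
    by (simp only: strategy_value_Suc[OF assms(1)] greedy_strategy_action[OF Suc.prems])
qed

lemma is_maximum_strategy_value:
  assumes "weighted_pomdp M"
  shows "is_maximum (value_fn M \<Delta> k h) (range (\<lambda>\<sigma>. strategy_value M \<Delta> \<sigma> k h))"
  unfolding is_maximum_def
  using strategy_value_greedy[OF assms refl, of \<Delta> k h, symmetric] strategy_value_le_value_fn[OF assms]
  by blast

theorem theorem3:
  fixes M\<^sub>0 M :: "('s::finite, 'a::finite, 'z::finite) wpomdp"
    and \<phi>\<^sub>1 \<phi>\<^sub>2 :: "'s \<Rightarrow> bool"
    and \<Delta> :: "'s set"
    and k :: nat
    and h :: "('a, 'z) history"
  assumes "weighted_pomdp M\<^sub>0"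
    and "M = make_absorbing (\<lambda>s. \<not> \<phi>\<^sub>1 s \<or> \<phi>\<^sub>2 s) M\<^sub>0"
    and "\<Delta> = {s. \<phi>\<^sub>2 s}"
  shows "is_maximum (value_fn M \<Delta> k h)
           (range (\<lambda>\<sigma>. path_mass M \<sigma> h k (bounded_until \<phi>\<^sub>1 \<phi>\<^sub>2 k)))
       \<and> is_maximum (value_fn M \<Delta> k h)
           (range (\<lambda>\<sigma>. path_mass M \<sigma> h k (bounded_reach \<Delta> k)))"
proof -
  have "weighted_pomdp M"
    using assms(1,2) weighted_pomdp_make_absorbing by blast
  moreover have "path_mass M \<sigma> h k (bounded_until \<phi>\<^sub>1 \<phi>\<^sub>2 k) = strategy_value M \<Delta> \<sigma> k h" for \<sigma>
    unfolding assms(3) by (rule path_mass_bounded_until[OF assms(2)])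
  \<comment> \<open>Reachability is until with a trivially true left operand, so
    \<open>\<psi>\<close> is constantly true here.\<close>
  moreover have "path_mass M \<sigma> h k (bounded_reach \<Delta> k) = strategy_value M \<Delta> \<sigma> k h" for \<sigma>
    unfolding assms(3) bounded_reach_eq_bounded_until
    by (rule path_mass_bounded_until[OF assms(2)]) simp
  ultimately show ?thesis
    by (simp add: is_maximum_strategy_value)
qed

end
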